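(* Let $(R,\mathfrak m)$ be a commutative noetherian local ring, let $I$ be an ideal of $R$, and let $M$ be a uniserial $R$-module of length $n\ge 1$. Put $\mathfrak a=\operatorname{Ann}_R(M)$. Then the following are equivalent: (i) $M$ is $I$-generated. (ii) $\mathfrak a=(\mathfrak a I):I$. (iii) $\mathfrak m^{n-1}\cdot I\not\subset \operatorname{Ann}_R(M)\cdot I$.
   Context: An $R$-module $M$ is called $I$-generated if there are an index set $\Lambda$ and an epimorphism $I^{(\Lambda)}\twoheadrightarrow M$ of $R$-modules, where $I^{(\Lambda)}$ is the direct sum of $\Lambda$ copies of the $R$-module $I$. An $R$-module $M$ is called uniserial if its lattice of submodules $\mathcal L(M)$ is totally ordered and finite (so $M$ has finite length). For ideals $\mathfrak b, I$ of $R$, $\mathfrak b:I=\{r\in R\mid rI\subset\mathfrak b\}$. By convention $\mathfrak m^0=R$. *)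

theory Defs
  imports "HOL-Algebra.Module" "HOL-Algebra.Ideal_Product" "HOL-Algebra.Ring_Divisibility"
begin

section \<open>Local rings and ideals\<close>

locale local_ring = cring R + maximalideal \<mm> R for R (structure) and \<mm> +
  assumes maximalideal_unique: "maximalideal J R \<Longrightarrow> J = \<mm>"

definition ideal_colon :: "('a, 'm) ring_scheme \<Rightarrow> 'a set \<Rightarrow> 'a set \<Rightarrow> 'a set"
  where "ideal_colon R B I = {r \<in> carrier R. \<forall>x\<in>I. r \<otimes>\<^bsub>R\<^esub> x \<in> B}"

section \<open>Modules\<close>

definition annihilator :: "('a, 'm) ring_scheme \<Rightarrow> ('a, 'b, 'd) module_scheme \<Rightarrow> 'a set"
  where "annihilator R M = {r \<in> carrier R. \<forall>x\<in>carrier M. r \<odot>\<^bsub>M\<^esub> x = \<zero>\<^bsub>M\<^esub>}"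

definition mod_hom ::
    "('a, 'm) ring_scheme \<Rightarrow> ('a, 'c, 'e) module_scheme \<Rightarrow> ('a, 'b, 'd) module_scheme \<Rightarrow> ('c \<Rightarrow> 'b) set"
  where "mod_hom R N M = {h \<in> carrier N \<rightarrow> carrier M.
    (\<forall>x\<in>carrier N. \<forall>y\<in>carrier N. h (x \<oplus>\<^bsub>N\<^esub> y) = h x \<oplus>\<^bsub>M\<^esub> h y) \<and>
    (\<forall>r\<in>carrier R. \<forall>x\<in>carrier N. h (r \<odot>\<^bsub>N\<^esub> x) = r \<odot>\<^bsub>M\<^esub> h x)}"

definition mod_epi ::
    "('a, 'm) ring_scheme \<Rightarrow> ('a, 'c, 'e) module_scheme \<Rightarrow> ('a, 'b, 'd) module_scheme \<Rightarrow> ('c \<Rightarrow> 'b) set"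
  where "mod_epi R N M = {h \<in> mod_hom R N M. h ` carrier N = carrier M}"

text \<open>In the two module records below, the fields \<open>mult\<close> and \<open>one\<close> are inherited from the ring
  record and play no role in the module structure.\<close>

definition ideal_module :: "('a, 'm) ring_scheme \<Rightarrow> 'a set \<Rightarrow> ('a, 'a) module"
  where "ideal_module R I =
    \<lparr>carrier = I, monoid.mult = (\<otimes>\<^bsub>R\<^esub>), one = \<one>\<^bsub>R\<^esub>, zero = \<zero>\<^bsub>R\<^esub>, add = (\<oplus>\<^bsub>R\<^esub>), smult = (\<otimes>\<^bsub>R\<^esub>)\<rparr>"

definition direct_sum_copies :: "('a, 'c, 'e) module_scheme \<Rightarrow> 'i set \<Rightarrow> ('a, 'i \<Rightarrow> 'c) module"
  where "direct_sum_copies N \<Lambda> =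
    \<lparr>carrier = {f \<in> \<Lambda> \<rightarrow>\<^sub>E carrier N. finite {i \<in> \<Lambda>. f i \<noteq> \<zero>\<^bsub>N\<^esub>}},
     monoid.mult = (\<lambda>f g. \<lambda>i\<in>\<Lambda>. f i \<otimes>\<^bsub>N\<^esub> g i), one = (\<lambda>i\<in>\<Lambda>. \<one>\<^bsub>N\<^esub>),
     zero = (\<lambda>i\<in>\<Lambda>. \<zero>\<^bsub>N\<^esub>), add = (\<lambda>f g. \<lambda>i\<in>\<Lambda>. f i \<oplus>\<^bsub>N\<^esub> g i),
     smult = (\<lambda>r f. \<lambda>i\<in>\<Lambda>. r \<odot>\<^bsub>N\<^esub> f i)\<rparr>"

text \<open>HOL cannot quantify over the type of the index set. Subsets of the type of functions from
  \<open>N\<close> to \<open>M\<close> are enough: by lemma \<open>generated_byI\<close> below, an epimorphism from a direct sum of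
  copies indexed by a set of any other type already yields one indexed by such a subset.\<close>

definition generated_by ::
    "('a, 'm) ring_scheme \<Rightarrow> ('a, 'c, 'e) module_scheme \<Rightarrow> ('a, 'b, 'd) module_scheme \<Rightarrow> bool"
  where "generated_by R N M \<longleftrightarrow>
    (\<exists>\<Lambda> :: ('c \<Rightarrow> 'b) set. \<exists>h. h \<in> mod_epi R (direct_sum_copies N \<Lambda>) M)"

definition uniserial :: "('a, 'm) ring_scheme \<Rightarrow> ('a, 'b, 'd) module_scheme \<Rightarrow> bool"
  where "uniserial R M \<longleftrightarrow> module R M \<and> finite {N. submodule N R M} \<and>
    (\<forall>N N'. submodule N R M \<longrightarrow> submodule N' R M \<longrightarrow> N \<subseteq> N' \<or> N' \<subseteq> N)"

text \<open>A composition series of length \<open>n\<close> is a chain of submodules, from zero to \<open>M\<close> in \<open>n\<close> proper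
  inclusions, that admits no refinement. By Jordan--Hoelder \<open>n\<close> is determined by \<open>M\<close>.\<close>

definition composition_series ::
    "('a, 'm) ring_scheme \<Rightarrow> ('a, 'b, 'd) module_scheme \<Rightarrow> nat \<Rightarrow> (nat \<Rightarrow> 'b set) \<Rightarrow> bool"
  where "composition_series R M n C \<longleftrightarrow>
    C 0 = {\<zero>\<^bsub>M\<^esub>} \<and> C n = carrier M \<and> (\<forall>i\<le>n. submodule (C i) R M) \<and>
    (\<forall>i<n. C i \<subset> C (Suc i) \<and> \<not> (\<exists>N. submodule N R M \<and> C i \<subset> N \<and> N \<subset> C (Suc i)))"

definition has_length :: "('a, 'm) ring_scheme \<Rightarrow> ('a, 'b, 'd) module_scheme \<Rightarrow> nat \<Rightarrow> bool"
  where "has_length R M n \<longleftrightarrow> (\<exists>C. composition_series R M n C)"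

section \<open>Adequacy of the module constructions\<close>

lemma ideal_module_module:
  assumes "cring R" "ideal I R"
  shows "module R (ideal_module R I)"
proof -
  interpret cring R by fact
  interpret ideal I R by fact
  have "abelian_group (ideal_module R I)"
  proof (rule abelian_groupI)
    fix x assume "x \<in> carrier (ideal_module R I)"
    then have "x \<in> I" by (simp add: ideal_module_def)
    then show "\<exists>y\<in>carrier (ideal_module R I). y \<oplus>\<^bsub>ideal_module R I\<^esub> x = \<zero>\<^bsub>ideal_module R I\<^esub>"
      by (intro bexI[of _ "\<ominus>\<^bsub>R\<^esub> x"]) (auto simp: ideal_module_def l_neg Icarr)
  qed (auto simp: ideal_module_def Icarr a_ac)
  then show ?thesis
    by (intro moduleI)
      (auto simp: ideal_module_def Icarr I_l_closed l_distr r_distr m_assoc is_cring)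
qed

lemma direct_sum_copies_module:
  assumes "module R N"
  shows "module R (direct_sum_copies N \<Lambda>)"
proof -
  interpret module R N by fact
  let ?D = "direct_sum_copies N \<Lambda>"
  have fin: "finite {i \<in> \<Lambda>. h (f i) (g i) \<noteq> \<zero>\<^bsub>N\<^esub>}"
    if "finite {i \<in> \<Lambda>. f i \<noteq> \<zero>\<^bsub>N\<^esub>}" "finite {i \<in> \<Lambda>. g i \<noteq> \<zero>\<^bsub>N\<^esub>}" "h \<zero>\<^bsub>N\<^esub> \<zero>\<^bsub>N\<^esub> = \<zero>\<^bsub>N\<^esub>"
    for h f g
  proof (rule finite_subset[OF _ finite_UnI[OF that(1,2)]])
    show "{i \<in> \<Lambda>. h (f i) (g i) \<noteq> \<zero>\<^bsub>N\<^esub>}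
        \<subseteq> {i \<in> \<Lambda>. f i \<noteq> \<zero>\<^bsub>N\<^esub>} \<union> {i \<in> \<Lambda>. g i \<noteq> \<zero>\<^bsub>N\<^esub>}"
      using that(3) by auto
  qed
  have eqI: "f = g" if "f \<in> extensional \<Lambda>" "g \<in> extensional \<Lambda>" "\<And>i. i \<in> \<Lambda> \<Longrightarrow> f i = g i"
    for f g :: "_ \<Rightarrow> 'c"
    using that by (rule extensionalityI)
  have cl: "f i \<in> carrier N" if "f \<in> carrier ?D" "i \<in> \<Lambda>" for f i
    using that by (auto simp: direct_sum_copies_def)
  have ext: "f \<in> extensional \<Lambda>" if "f \<in> carrier ?D" for f
    using that by (auto simp: direct_sum_copies_def PiE_def)
  have fin1: "finite {i \<in> \<Lambda>. f i \<noteq> \<zero>\<^bsub>N\<^esub>}" if "f \<in> carrier ?D" for f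
    using that by (auto simp: direct_sum_copies_def)
  have memI: "f \<in> carrier ?D"
    if "f \<in> extensional \<Lambda>" "\<And>i. i \<in> \<Lambda> \<Longrightarrow> f i \<in> carrier N" "finite {i \<in> \<Lambda>. f i \<noteq> \<zero>\<^bsub>N\<^esub>}" for f
    using that by (auto simp: direct_sum_copies_def PiE_def)
  have add: "f \<oplus>\<^bsub>?D\<^esub> g = (\<lambda>i\<in>\<Lambda>. f i \<oplus>\<^bsub>N\<^esub> g i)" and zero: "\<zero>\<^bsub>?D\<^esub> = (\<lambda>i\<in>\<Lambda>. \<zero>\<^bsub>N\<^esub>)"
    and smult: "r \<odot>\<^bsub>?D\<^esub> f = (\<lambda>i\<in>\<Lambda>. r \<odot>\<^bsub>N\<^esub> f i)" for f g r
    by (simp_all add: direct_sum_copies_def)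
  have zero_mem: "\<zero>\<^bsub>?D\<^esub> \<in> carrier ?D"
    unfolding zero by (rule memI) auto
  have add_mem: "f \<oplus>\<^bsub>?D\<^esub> g \<in> carrier ?D" if "f \<in> carrier ?D" "g \<in> carrier ?D" for f g
    unfolding add using fin[OF fin1[OF that(1)] fin1[OF that(2)], of "(\<oplus>\<^bsub>N\<^esub>)"] that
    by (intro memI) (auto simp: cl cong: conj_cong)
  have smult_mem: "r \<odot>\<^bsub>?D\<^esub> f \<in> carrier ?D" if "r \<in> carrier R" "f \<in> carrier ?D" for r f
    unfolding smult using fin[OF fin1[OF that(2)] fin1[OF that(2)], of "\<lambda>x y. r \<odot>\<^bsub>N\<^esub> x"] that
    by (intro memI) (auto simp: cl cong: conj_cong)
  have "abelian_group ?D"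
  proof (rule abelian_groupI)
    fix f assume f: "f \<in> carrier ?D"
    let ?g = "\<lambda>i\<in>\<Lambda>. \<ominus>\<^bsub>N\<^esub> f i"
    have "?g \<in> carrier ?D"
      using fin[OF fin1[OF f] fin1[OF f], of "\<lambda>x y. \<ominus>\<^bsub>N\<^esub> x"] f
      by (intro memI) (auto simp: cl cong: conj_cong)
    moreover have "?g \<oplus>\<^bsub>?D\<^esub> f = \<zero>\<^bsub>?D\<^esub>"
      unfolding add zero by (rule restrict_ext) (simp add: cl[OF f] M.l_neg)
    ultimately show "\<exists>g\<in>carrier ?D. g \<oplus>\<^bsub>?D\<^esub> f = \<zero>\<^bsub>?D\<^esub>" by blast
  next
    fix f assume f: "f \<in> carrier ?D"
    show "\<zero>\<^bsub>?D\<^esub> \<oplus>\<^bsub>?D\<^esub> f = f"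
      unfolding add zero by (rule eqI) (auto simp: ext[OF f] cl[OF f])
  next
    fix f g assume "f \<in> carrier ?D" "g \<in> carrier ?D"
    then show "f \<oplus>\<^bsub>?D\<^esub> g = g \<oplus>\<^bsub>?D\<^esub> f"
      unfolding add by (intro restrict_ext) (simp add: cl M.a_comm)
  next
    fix f g h assume "f \<in> carrier ?D" "g \<in> carrier ?D" "h \<in> carrier ?D"
    then show "f \<oplus>\<^bsub>?D\<^esub> g \<oplus>\<^bsub>?D\<^esub> h = f \<oplus>\<^bsub>?D\<^esub> (g \<oplus>\<^bsub>?D\<^esub> h)"
      unfolding add by (intro restrict_ext) (simp add: cl M.a_assoc)
  qed (auto simp: add_mem zero_mem)
  then show ?thesis
  proof (rule moduleI[OF is_cring])
    fix f assume f: "f \<in> carrier ?D"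
    show "\<one>\<^bsub>R\<^esub> \<odot>\<^bsub>?D\<^esub> f = f"
      unfolding smult by (rule eqI) (auto simp: ext[OF f] cl[OF f])
  qed (auto simp: smult_mem, auto simp: smult add cl smult_l_distr smult_r_distr smult_assoc1
      intro!: restrict_ext)
qed

lemma generated_byI:
  fixes \<Lambda> :: "'i set" and N :: "('a, 'c, 'e) module_scheme" and M :: "('a, 'b, 'd) module_scheme"
  assumes N: "module R N" and M: "module R M" and h: "h \<in> mod_epi R (direct_sum_copies N \<Lambda>) M"
  shows "generated_by R N M"
proof -
  interpret N: module R N by fact
  interpret M: module R M by fact
  let ?D = "direct_sum_copies N \<Lambda>"
  interpret D: module R ?D by (rule direct_sum_copies_module[OF N])
  have h_cl: "\<And>x. x \<in> carrier ?D \<Longrightarrow> h x \<in> carrier M"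
    and h_add: "\<And>x y. x \<in> carrier ?D \<Longrightarrow> y \<in> carrier ?D \<Longrightarrow> h (x \<oplus>\<^bsub>?D\<^esub> y) = h x \<oplus>\<^bsub>M\<^esub> h y"
    and h_smult: "\<And>r x. r \<in> carrier R \<Longrightarrow> x \<in> carrier ?D \<Longrightarrow> h (r \<odot>\<^bsub>?D\<^esub> x) = r \<odot>\<^bsub>M\<^esub> h x"
    and h_surj: "h ` carrier ?D = carrier M"
    using h by (auto simp: mod_epi_def mod_hom_def)
  define inj where "inj i x = (\<lambda>j\<in>\<Lambda>. if j = i then x else \<zero>\<^bsub>N\<^esub>)" for i x
  define \<phi> where "\<phi> i = (\<lambda>x\<in>carrier N. h (inj i x))" for i
  define s where "s = inv_into \<Lambda> \<phi>"
  define \<Lambda>' where "\<Lambda>' = \<phi> ` \<Lambda>"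
  let ?D' = "direct_sum_copies N \<Lambda>'"
  interpret D': module R ?D' by (rule direct_sum_copies_module[OF N])
  have s_mem: "s f \<in> \<Lambda>" and \<phi>_s: "\<phi> (s f) = f" if "f \<in> \<Lambda>'" for f
    using that unfolding \<Lambda>'_def s_def by (auto intro: inv_into_into f_inv_into_f)
  define T where "T g = (\<lambda>i\<in>\<Lambda>. if s (\<phi> i) = i then g (\<phi> i) else \<zero>\<^bsub>N\<^esub>)" for g :: "('c \<Rightarrow> 'b) \<Rightarrow> 'c"
  have T_cl: "T g \<in> carrier ?D" if g: "g \<in> carrier ?D'" for g
  proof -
    have "{i \<in> \<Lambda>. T g i \<noteq> \<zero>\<^bsub>N\<^esub>} \<subseteq> s ` {f \<in> \<Lambda>'. g f \<noteq> \<zero>\<^bsub>N\<^esub>}"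
    proof
      fix i assume i: "i \<in> {i \<in> \<Lambda>. T g i \<noteq> \<zero>\<^bsub>N\<^esub>}"
      then have "s (\<phi> i) = i" "g (\<phi> i) \<noteq> \<zero>\<^bsub>N\<^esub>" "\<phi> i \<in> \<Lambda>'"
        by (auto simp: T_def \<Lambda>'_def split: if_splits)
      then show "i \<in> s ` {f \<in> \<Lambda>'. g f \<noteq> \<zero>\<^bsub>N\<^esub>}" by force
    qed
    then have "finite {i \<in> \<Lambda>. T g i \<noteq> \<zero>\<^bsub>N\<^esub>}"
      by (rule finite_subset) (use g in \<open>auto simp: direct_sum_copies_def\<close>)
    moreover have "T g \<in> \<Lambda> \<rightarrow>\<^sub>E carrier N"
      using g by (auto simp: T_def direct_sum_copies_def \<Lambda>'_def)
    ultimately show ?thesis by (simp add: direct_sum_copies_def)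
  qed
  have T_add: "T (f \<oplus>\<^bsub>?D'\<^esub> g) = T f \<oplus>\<^bsub>?D\<^esub> T g" for f g
    by (auto simp: T_def direct_sum_copies_def \<Lambda>'_def intro!: restrict_ext)
  have T_smult: "T (r \<odot>\<^bsub>?D'\<^esub> g) = r \<odot>\<^bsub>?D\<^esub> T g" if "r \<in> carrier R" for r g
    using that by (auto simp: T_def direct_sum_copies_def \<Lambda>'_def intro!: restrict_ext)
  have hT: "(\<lambda>g. h (T g)) \<in> mod_hom R ?D' M"
    by (simp add: mod_hom_def T_cl T_add T_smult h_cl h_add h_smult)
  have inj_cl: "inj i x \<in> carrier ?D" if "i \<in> \<Lambda>" "x \<in> carrier N" for i x
  proof -
    have "{j \<in> \<Lambda>. inj i x j \<noteq> \<zero>\<^bsub>N\<^esub>} \<subseteq> {i}" by (auto simp: inj_def)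
    then have "finite {j \<in> \<Lambda>. inj i x j \<noteq> \<zero>\<^bsub>N\<^esub>}" by (rule finite_subset) simp
    then show ?thesis using that by (auto simp: direct_sum_copies_def inj_def)
  qed
  have inj_img: "h (inj i x) \<in> (\<lambda>g. h (T g)) ` carrier ?D'"
    if i: "i \<in> \<Lambda>" and x: "x \<in> carrier N" for i x
  proof -
    have \<phi>i: "\<phi> i \<in> \<Lambda>'" using i by (simp add: \<Lambda>'_def)
    define g where "g = (\<lambda>f\<in>\<Lambda>'. if f = \<phi> i then x else \<zero>\<^bsub>N\<^esub>)"
    have "{f \<in> \<Lambda>'. g f \<noteq> \<zero>\<^bsub>N\<^esub>} \<subseteq> {\<phi> i}" by (auto simp: g_def)
    then have "finite {f \<in> \<Lambda>'. g f \<noteq> \<zero>\<^bsub>N\<^esub>}" by (rule finite_subset) simp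
    then have g: "g \<in> carrier ?D'" using x by (auto simp: direct_sum_copies_def g_def)
    have "T g = inj (s (\<phi> i)) x"
      unfolding T_def inj_def using i
      by (intro restrict_ext) (auto simp: g_def \<Lambda>'_def \<phi>_s[OF \<phi>i])
    then have "h (T g) = \<phi> (s (\<phi> i)) x" using x by (simp add: \<phi>_def)
    also have "\<dots> = h (inj i x)" using x by (simp only: \<phi>_s[OF \<phi>i]) (simp add: \<phi>_def)
    finally show ?thesis using g by (metis image_eqI)
  qed
  have img: "h x \<in> (\<lambda>g. h (T g)) ` carrier ?D'" if "x \<in> carrier ?D" for x
    using that
  proof (induction "card {i \<in> \<Lambda>. x i \<noteq> \<zero>\<^bsub>N\<^esub>}" arbitrary: x)
    case (0 x)
    then have "\<forall>i\<in>\<Lambda>. x i = \<zero>\<^bsub>N\<^esub>" by (auto simp: direct_sum_copies_def)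
    then have "x = T \<zero>\<^bsub>?D'\<^esub>"
      using 0 by (intro extensionalityI[where A = \<Lambda>])
        (auto simp: T_def direct_sum_copies_def PiE_def \<Lambda>'_def)
    then show ?case using D'.M.zero_closed by (metis image_eqI)
  next
    case (Suc k x)
    then have fin: "finite {i \<in> \<Lambda>. x i \<noteq> \<zero>\<^bsub>N\<^esub>}" by (simp add: direct_sum_copies_def)
    from Suc have "{i \<in> \<Lambda>. x i \<noteq> \<zero>\<^bsub>N\<^esub>} \<noteq> {}" by (metis card.empty nat.distinct(1))
    then obtain i where i: "i \<in> \<Lambda>" "x i \<noteq> \<zero>\<^bsub>N\<^esub>" by auto
    have xi: "x i \<in> carrier N" using Suc.prems i by (auto simp: direct_sum_copies_def)
    define y where "y = (\<lambda>j\<in>\<Lambda>. if j = i then \<zero>\<^bsub>N\<^esub> else x j)"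
    have supp: "{j \<in> \<Lambda>. y j \<noteq> \<zero>\<^bsub>N\<^esub>} = {j \<in> \<Lambda>. x j \<noteq> \<zero>\<^bsub>N\<^esub>} - {i}" by (auto simp: y_def)
    have y: "y \<in> carrier ?D"
    proof -
      have "y \<in> \<Lambda> \<rightarrow>\<^sub>E carrier N"
        using Suc.prems by (auto simp: y_def direct_sum_copies_def)
      then show ?thesis using fin by (simp add: direct_sum_copies_def supp)
    qed
    have "k = card {j \<in> \<Lambda>. y j \<noteq> \<zero>\<^bsub>N\<^esub>}"
      unfolding supp using Suc.hyps(2) i fin by (simp add: card_Diff_singleton)
    from Suc.hyps(1)[OF this y] obtain g where g: "g \<in> carrier ?D'" "h y = h (T g)" by auto
    from inj_img[OF i(1) xi] obtain g' where g': "g' \<in> carrier ?D'" "h (inj i (x i)) = h (T g')"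
      by auto
    have "x = y \<oplus>\<^bsub>?D\<^esub> inj i (x i)"
      using Suc.prems by (intro extensionalityI[where A = \<Lambda>])
        (auto simp: y_def inj_def direct_sum_copies_def PiE_def Pi_def)
    then have "h x = h (T (g \<oplus>\<^bsub>?D'\<^esub> g'))"
      using h_add[OF y inj_cl[OF i(1) xi]] g g' by (simp add: T_add T_cl h_add)
    moreover have "g \<oplus>\<^bsub>?D'\<^esub> g' \<in> carrier ?D'" using g g' by simp
    ultimately show ?case by blast
  qed
  have "(\<lambda>g. h (T g)) ` carrier ?D' = carrier M"
    using img T_cl h_cl unfolding h_surj[symmetric] by blast
  with hT have "(\<lambda>g. h (T g)) \<in> mod_epi R ?D' M" by (simp add: mod_epi_def)
  then show ?thesis unfolding generated_by_def by blast
qed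

end

theory Submission
  imports Defs
begin

text \<open>
  Write \<open>\<aa>\<close> for the annihilator of \<open>M\<close>. Submodules of a uniserial module are cyclic, so
  \<open>M = R x\<close> is a copy of \<open>R / \<aa>\<close>, and its composition series is
  \<open>M \<supset> \<mm> x \<supset> \<mm>\<^sup>2 x \<supset> \<dots> \<supset> \<mm>\<^sup>n x = 0\<close> (\<open>maximal_power_smult\<close>). Hence \<open>\<mm>\<^sup>n\<^sup>-\<^sup>1\<close> is not
  contained in \<open>\<aa>\<close>, but it is contained in every ideal that properly contains \<open>\<aa>\<close>
  (\<open>ideal_above_annihilator\<close>): it represents the socle of \<open>R / \<aa>\<close>.

  The equivalence is proved as a cycle.

  \<^item> If \<open>I\<close> generates \<open>M\<close> and \<open>r I \<subseteq> \<aa> I\<close>, then \<open>r\<close> kills \<open>M\<close>, because homomorphisms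
    \<open>I \<rightarrow> M\<close> vanish on \<open>\<aa> I\<close> (\<open>generated_imp_colon\<close>).

  \<^item> If \<open>\<mm>\<^sup>n\<^sup>-\<^sup>1 I \<subseteq> \<aa> I\<close>, then \<open>\<mm>\<^sup>n\<^sup>-\<^sup>1\<close> lies in the colon ideal but not in \<open>\<aa>\<close>.

  \<^item> If \<open>\<mm>\<^sup>n\<^sup>-\<^sup>1 I\<close> is not contained in \<open>\<aa> I\<close>, some \<open>u \<in> I\<close> is not carried into \<open>\<aa> I\<close> by
    \<open>\<mm>\<^sup>n\<^sup>-\<^sup>1\<close>. Then the annihilator of \<open>u\<close> modulo \<open>\<aa> I\<close> is exactly \<open>\<aa>\<close>, so \<open>u \<mapsto> x\<close> defines
    a homomorphism \<open>R u + \<aa> I \<rightarrow> M\<close> killing \<open>\<aa> I\<close>. Since \<open>R / \<aa>\<close> is self-injective, it extends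
    to \<open>I\<close>, and the extension is onto because it hits \<open>x\<close> (\<open>generated_if_not_subset\<close>).

  Self-injectivity enters only through \<open>hom_extension_value\<close>, which extends a homomorphism by
  one element. Such an extension amounts to dividing an element of \<open>M\<close> by a ring element
  modulo \<open>\<aa>\<close>; the division is possible because in \<open>M\<close> an element killed by the annihilator of
  \<open>z\<close> is a multiple of \<open>z\<close> (\<open>annihilated_imp_mem_cyclic\<close>). As \<open>R\<close> is noetherian,
  the ideals inside \<open>I\<close> to which the homomorphism extends have a maximal member, which must
  then be \<open>I\<close>.
\<close>

section \<open>Noetherian local rings\<close>

lemma (in noetherian_ring) ideals_have_maximal:
  assumes "S \<noteq> {}" and "\<And>J. J \<in> S \<Longrightarrow> ideal J R"
  obtains N where "N \<in> S" and "\<And>J. J \<in> S \<Longrightarrow> N \<subseteq> J \<Longrightarrow> J = N"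
proof -
  have "\<exists>N \<in> S. \<forall>J \<in> S. N \<subseteq> J \<longrightarrow> J = N"
  proof (rule subset_Zorn)
    fix C assume C: "subset.chain S C"
    show "\<exists>U \<in> S. \<forall>J \<in> C. J \<subseteq> U"
    proof (cases "C = {}")
      case True
      then show ?thesis using assms(1) by auto
    next
      case False
      have "subset.chain {J. ideal J R} C"
        using C assms(2) unfolding pred_on.chain_def by auto
      then have "\<Union>C \<in> C" using False by (rule ideal_chain_is_trivial[rotated])
      then show ?thesis by (meson C Union_upper pred_on.chain_def subsetCE)
    qed
  qed
  then show thesis using that by blast
qed

text \<open>A maximal proper ideal containing a non-unit \<open>r\<close> has to be \<open>\<mm>\<close>.\<close>

lemma local_ring_unit:
  fixes R (structure)
  assumes "local_ring R \<mm>" and "noetherian_ring R"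
    and r: "r \<in> carrier R" "r \<notin> \<mm>"
  shows "r \<in> Units R"
proof (rule ccontr)
  assume nu: "r \<notin> Units R"
  interpret local_ring R \<mm> by fact
  interpret noetherian_ring R by fact
  let ?S = "{J. ideal J R \<and> r \<in> J \<and> J \<noteq> carrier R}"
  have "PIdl r \<in> ?S"
    using r(1) nu cgenideal_ideal cgenideal_self ideal_eq_carrier_iff by auto
  then obtain N where N: "N \<in> ?S" and max: "\<And>J. J \<in> ?S \<Longrightarrow> N \<subseteq> J \<Longrightarrow> J = N"
    using ideals_have_maximal[of ?S] by blast
  have "maximalideal N R"
  proof (rule maximalidealI)
    fix J assume "ideal J R" "N \<subseteq> J" "J \<subseteq> carrier R"
    then show "J = N \<or> J = carrier R" using max[of J] N by blast
  qed (use N in auto)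
  then have "N = \<mm>" by (rule maximalideal_unique)
  then show False using N r(2) by blast
qed

section \<open>Homomorphisms from ideals to modules\<close>

lemma (in cring) ideal_adjoin:
  assumes N: "ideal N R" and v: "v \<in> carrier R"
  shows "ideal (N <+> PIdl v) R" and "N \<subseteq> N <+> PIdl v" and "v \<in> N <+> PIdl v"
    and "ideal I R \<Longrightarrow> N \<subseteq> I \<Longrightarrow> v \<in> I \<Longrightarrow> N <+> PIdl v \<subseteq> I"
proof -
  have eq: "N <+> PIdl v = Idl (N \<union> PIdl v)"
    by (rule union_genideal[OF N cgenideal_ideal[OF v], symmetric])
  have sub: "N \<union> PIdl v \<subseteq> carrier R"
    using ideal.Icarr[OF N] ideal.Icarr[OF cgenideal_ideal[OF v]] by blast
  show "ideal (N <+> PIdl v) R" unfolding eq by (rule genideal_ideal[OF sub])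
  show "N \<subseteq> N <+> PIdl v" unfolding eq using genideal_self[OF sub] by blast
  show "v \<in> N <+> PIdl v" unfolding eq using genideal_self[OF sub] cgenideal_self[OF v] by blast
  show "N <+> PIdl v \<subseteq> I" if I: "ideal I R" and "N \<subseteq> I" "v \<in> I"
    unfolding eq using that cgenideal_minimal[OF I \<open>v \<in> I\<close>] by (intro genideal_minimal) auto
qed

lemma mod_hom_ideal_module:
  "f \<in> mod_hom R (ideal_module R N) M \<longleftrightarrow> f \<in> N \<rightarrow> carrier M \<and>
    (\<forall>x\<in>N. \<forall>y\<in>N. f (x \<oplus>\<^bsub>R\<^esub> y) = f x \<oplus>\<^bsub>M\<^esub> f y) \<and>
    (\<forall>r\<in>carrier R. \<forall>x\<in>N. f (r \<otimes>\<^bsub>R\<^esub> x) = r \<odot>\<^bsub>M\<^esub> f x)"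
  by (simp add: mod_hom_def ideal_module_def)

text \<open>A single copy of \<open>I\<close> suffices, so the direct sum is indexed by the unit type.\<close>

lemma surjection_imp_generated_by:
  fixes R (structure)
  assumes M: "module R M" and I: "ideal I R"
    and f: "f \<in> mod_hom R (ideal_module R I) M" and surj: "f ` I = carrier M"
  shows "generated_by R (ideal_module R I) M"
proof -
  interpret module R M by fact
  let ?D = "direct_sum_copies (ideal_module R I) {()}"
  have carr: "carrier ?D = {()} \<rightarrow>\<^sub>E I" by (simp add: direct_sum_copies_def ideal_module_def)
  have comp: "g () \<in> I" if "g \<in> {()} \<rightarrow>\<^sub>E I" for g using that by (rule PiE_mem) simp
  have "(\<lambda>g. f (g ())) \<in> mod_hom R ?D M"
    using f comp unfolding mod_hom_ideal_module
    unfolding mod_hom_def carr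
    by (auto simp: direct_sum_copies_def ideal_module_def)
  moreover have "(\<lambda>g. f (g ())) ` ({()} \<rightarrow>\<^sub>E I) = carrier M"
  proof
    show "(\<lambda>g. f (g ())) ` ({()} \<rightarrow>\<^sub>E I) \<subseteq> carrier M" using surj by auto
    show "carrier M \<subseteq> (\<lambda>g. f (g ())) ` ({()} \<rightarrow>\<^sub>E I)"
    proof
      fix y assume "y \<in> carrier M"
      then obtain w where "w \<in> I" "y = f w" using surj by auto
      then show "y \<in> (\<lambda>g. f (g ())) ` ({()} \<rightarrow>\<^sub>E I)"
        by (intro image_eqI[where x = "\<lambda>i\<in>{()}. w"]) auto
    qed
  qed
  ultimately have "(\<lambda>g. f (g ())) \<in> mod_epi R ?D M" by (simp add: mod_epi_def carr)
  then show ?thesis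
    by (rule generated_byI[OF ideal_module_module[OF R.is_cring I] M])
qed

context module
begin

lemma smult_eq_imp_diff_zero:
  assumes "r \<in> carrier R" "s \<in> carrier R" "x \<in> carrier M" "r \<odot>\<^bsub>M\<^esub> x = s \<odot>\<^bsub>M\<^esub> x"
  shows "(r \<ominus> s) \<odot>\<^bsub>M\<^esub> x = \<zero>\<^bsub>M\<^esub>"
  using assms by (simp add: a_minus_def smult_l_distr smult_l_minus M.r_neg)

lemma annihilator_ideal: "ideal (annihilator R M) R"
proof (rule idealI)
  show "subgroup (annihilator R M) (add_monoid R)"
    by (rule R.add.subgroupI)
      (auto simp: annihilator_def smult_l_distr smult_l_minus a_inv_def[symmetric] intro: exI[of _ \<zero>])
qed (auto simp: annihilator_def smult_assoc1 R.ring_axioms R.m_comm)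

lemma submodule_ideal_smult:
  assumes J: "ideal J R" and x: "x \<in> carrier M"
  shows "submodule ((\<lambda>r. r \<odot>\<^bsub>M\<^esub> x) ` J) R M"
proof -
  interpret ideal J R by fact
  show ?thesis
  proof (rule submoduleI)
    show "\<zero>\<^bsub>M\<^esub> \<in> (\<lambda>r. r \<odot>\<^bsub>M\<^esub> x) ` J"
      using x by (intro image_eqI[of _ _ \<zero>]) auto
  next
    fix a assume "a \<in> (\<lambda>r. r \<odot>\<^bsub>M\<^esub> x) ` J"
    then obtain r where "r \<in> J" "a = r \<odot>\<^bsub>M\<^esub> x" by auto
    then show "\<ominus>\<^bsub>M\<^esub> a \<in> (\<lambda>r. r \<odot>\<^bsub>M\<^esub> x) ` J"
      using x by (intro image_eqI[of _ _ "\<ominus> r"]) (auto simp: smult_l_minus Icarr)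
  next
    fix a b assume "a \<in> (\<lambda>r. r \<odot>\<^bsub>M\<^esub> x) ` J" "b \<in> (\<lambda>r. r \<odot>\<^bsub>M\<^esub> x) ` J"
    then obtain r s where "r \<in> J" "a = r \<odot>\<^bsub>M\<^esub> x" "s \<in> J" "b = s \<odot>\<^bsub>M\<^esub> x" by auto
    then show "a \<oplus>\<^bsub>M\<^esub> b \<in> (\<lambda>r. r \<odot>\<^bsub>M\<^esub> x) ` J"
      using x by (intro image_eqI[of _ _ "r \<oplus> s"]) (auto simp: smult_l_distr Icarr)
  next
    fix a b assume "a \<in> carrier R" "b \<in> (\<lambda>r. r \<odot>\<^bsub>M\<^esub> x) ` J"
    then obtain r where "r \<in> J" "b = r \<odot>\<^bsub>M\<^esub> x" by auto
    then show "a \<odot>\<^bsub>M\<^esub> b \<in> (\<lambda>r. r \<odot>\<^bsub>M\<^esub> x) ` J"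
      using x \<open>a \<in> carrier R\<close> by (intro image_eqI[of _ _ "a \<otimes> r"]) (auto simp: smult_assoc1 Icarr I_l_closed)
  qed (use x in \<open>auto simp: Icarr\<close>)
qed

lemma submodule_cyclic:
  "x \<in> carrier M \<Longrightarrow> submodule ((\<lambda>r. r \<odot>\<^bsub>M\<^esub> x) ` carrier R) R M"
  by (rule submodule_ideal_smult[OF R.oneideal])

text \<open>The extension is \<open>w + r v \<mapsto> f w + r y\<close>; the compatibility hypothesis says exactly that this
  does not depend on the choice of \<open>w\<close> and \<open>r\<close>.\<close>

lemma extend_hom_by_element:
  assumes N: "ideal N R" and f: "f \<in> mod_hom R (ideal_module R N) M"
    and v: "v \<in> carrier R" and y: "y \<in> carrier M"
    and compat: "\<And>r. r \<in> carrier R \<Longrightarrow> r \<otimes> v \<in> N \<Longrightarrow> f (r \<otimes> v) = r \<odot>\<^bsub>M\<^esub> y"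
  obtains g where "g \<in> mod_hom R (ideal_module R (N <+>\<^bsub>R\<^esub> PIdl v)) M"
    and "\<And>w. w \<in> N \<Longrightarrow> g w = f w" and "g v = y"
proof -
  interpret N: ideal N R by fact
  have f_cl: "\<And>w. w \<in> N \<Longrightarrow> f w \<in> carrier M"
    and f_add: "\<And>w w'. w \<in> N \<Longrightarrow> w' \<in> N \<Longrightarrow> f (w \<oplus> w') = f w \<oplus>\<^bsub>M\<^esub> f w'"
    and f_smult: "\<And>r w. r \<in> carrier R \<Longrightarrow> w \<in> N \<Longrightarrow> f (r \<otimes> w) = r \<odot>\<^bsub>M\<^esub> f w"
    using f unfolding mod_hom_ideal_module by auto
  have f_zero: "f \<zero> = \<zero>\<^bsub>M\<^esub>"
    using f_smult[of \<zero> \<zero>] by (simp add: f_cl)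
  let ?N' = "N <+>\<^bsub>R\<^esub> PIdl v"
  have mem: "t \<in> ?N' \<longleftrightarrow> (\<exists>w\<in>N. \<exists>r\<in>carrier R. t = w \<oplus> r \<otimes> v)" for t
    by (auto simp: set_add_def' cgenideal_def)
  have uniq: "f w \<oplus>\<^bsub>M\<^esub> r \<odot>\<^bsub>M\<^esub> y = f w' \<oplus>\<^bsub>M\<^esub> s \<odot>\<^bsub>M\<^esub> y"
    if w: "w \<in> N" "w' \<in> N" and r: "r \<in> carrier R" "s \<in> carrier R"
      and eq: "w \<oplus> r \<otimes> v = w' \<oplus> s \<otimes> v" for w w' r s
  proof -
    have wc: "w \<in> carrier R" "w' \<in> carrier R" using w by (auto simp: N.Icarr)
    have eq': "(r \<ominus> s) \<otimes> v = w' \<ominus> w"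
    proof -
      have "(r \<ominus> s) \<otimes> v = \<ominus> w \<oplus> (w \<oplus> r \<otimes> v) \<ominus> s \<otimes> v"
        using wc r v by algebra
      also have "\<dots> = w' \<ominus> w" unfolding eq using wc r v by algebra
      finally show ?thesis .
    qed
    have d: "(r \<ominus> s) \<otimes> v \<in> N"
      unfolding eq' unfolding a_minus_def using w by (intro N.a_closed N.a_inv_closed)
    have w': "w' = w \<oplus> (r \<ominus> s) \<otimes> v"
      unfolding eq' unfolding a_minus_def using wc R.r_neg2[of w w'] by (simp add: R.a_comm[of w' "\<ominus> w"])
    have "f w' = f w \<oplus>\<^bsub>M\<^esub> (r \<ominus> s) \<odot>\<^bsub>M\<^esub> y"
      unfolding w' using f_add[OF w(1) d] compat[OF _ d] r by simp
    also have "\<dots> \<oplus>\<^bsub>M\<^esub> s \<odot>\<^bsub>M\<^esub> y = f w \<oplus>\<^bsub>M\<^esub> ((r \<ominus> s) \<oplus> s) \<odot>\<^bsub>M\<^esub> y"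
      using r w y by (simp add: smult_l_distr f_cl M.a_assoc)
    also have "(r \<ominus> s) \<oplus> s = r" using r by algebra
    finally show ?thesis by simp
  qed
  define g where "g t = (THE z. \<exists>w\<in>N. \<exists>r\<in>carrier R. t = w \<oplus> r \<otimes> v \<and> z = f w \<oplus>\<^bsub>M\<^esub> r \<odot>\<^bsub>M\<^esub> y)" for t
  have g_eq: "g (w \<oplus> r \<otimes> v) = f w \<oplus>\<^bsub>M\<^esub> r \<odot>\<^bsub>M\<^esub> y" if "w \<in> N" "r \<in> carrier R" for w r
    unfolding g_def
  proof (rule the_equality)
    show "\<exists>w'\<in>N. \<exists>r'\<in>carrier R. w \<oplus> r \<otimes> v = w' \<oplus> r' \<otimes> v \<and>
        f w \<oplus>\<^bsub>M\<^esub> r \<odot>\<^bsub>M\<^esub> y = f w' \<oplus>\<^bsub>M\<^esub> r' \<odot>\<^bsub>M\<^esub> y"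
      using that by blast
  next
    fix z
    assume "\<exists>w'\<in>N. \<exists>r'\<in>carrier R. w \<oplus> r \<otimes> v = w' \<oplus> r' \<otimes> v \<and>
        z = f w' \<oplus>\<^bsub>M\<^esub> r' \<odot>\<^bsub>M\<^esub> y"
    then obtain w' r' where "w' \<in> N" "r' \<in> carrier R" "w \<oplus> r \<otimes> v = w' \<oplus> r' \<otimes> v"
      and z: "z = f w' \<oplus>\<^bsub>M\<^esub> r' \<odot>\<^bsub>M\<^esub> y"
      by (elim bexE conjE)
    then show "z = f w \<oplus>\<^bsub>M\<^esub> r \<odot>\<^bsub>M\<^esub> y"
      unfolding z using that by (intro uniq) simp_all
  qed
  have "g \<in> mod_hom R (ideal_module R ?N') M"
    unfolding mod_hom_ideal_module
  proof (intro conjI ballI funcsetI)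
    fix t assume "t \<in> ?N'"
    then show "g t \<in> carrier M" using y by (auto simp: mem g_eq f_cl)
  next
    fix t t' assume "t \<in> ?N'" "t' \<in> ?N'"
    then obtain w r w' r' where w: "w \<in> N" "w' \<in> N" and r: "r \<in> carrier R" "r' \<in> carrier R"
      and t: "t = w \<oplus> r \<otimes> v" "t' = w' \<oplus> r' \<otimes> v" by (auto simp: mem)
    have "t \<oplus> t' = (w \<oplus> w') \<oplus> (r \<oplus> r') \<otimes> v"
      using w[THEN N.Icarr] r v unfolding t by algebra
    then have "g (t \<oplus> t') = f (w \<oplus> w') \<oplus>\<^bsub>M\<^esub> (r \<oplus> r') \<odot>\<^bsub>M\<^esub> y"
      using w r by (simp add: g_eq)
    then show "g (t \<oplus> t') = g t \<oplus>\<^bsub>M\<^esub> g t'"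
      using w r y by (simp add: t g_eq f_add f_cl smult_l_distr M.a_ac)
  next
    fix s t assume s: "s \<in> carrier R" and "t \<in> ?N'"
    then obtain w r where w: "w \<in> N" and r: "r \<in> carrier R" and t: "t = w \<oplus> r \<otimes> v"
      by (auto simp: mem)
    have "s \<otimes> t = s \<otimes> w \<oplus> (s \<otimes> r) \<otimes> v"
      using w[THEN N.Icarr] r s v unfolding t by algebra
    then have "g (s \<otimes> t) = f (s \<otimes> w) \<oplus>\<^bsub>M\<^esub> (s \<otimes> r) \<odot>\<^bsub>M\<^esub> y"
      using w r s by (simp add: g_eq N.I_l_closed)
    then show "g (s \<otimes> t) = s \<odot>\<^bsub>M\<^esub> g t"
      using w r s y by (simp add: t g_eq f_smult f_cl smult_r_distr smult_assoc1)
  qed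
  moreover have "g w = f w" if "w \<in> N" for w
    using g_eq[OF that, of \<zero>] that v y by (simp add: N.Icarr f_cl)
  moreover have "g v = y"
    using g_eq[of \<zero> \<one>] v y by (simp add: f_zero)
  ultimately show thesis by (rule that)
qed

text \<open>On products, \<open>f (a w) = a f(w) = 0\<close>. Restricting to homomorphisms defined on all of \<open>I\<close>
  matters: on an ideal between \<open>\<aa> I\<close> and \<open>I\<close> the factor \<open>w\<close> may lie outside the domain.\<close>

lemma hom_kills_annihilator_prod:
  assumes I: "ideal I R" and f: "f \<in> mod_hom R (ideal_module R I) M"
    and w: "w \<in> annihilator R M \<cdot> I"
  shows "f w = \<zero>\<^bsub>M\<^esub>"
proof -
  have sub: "annihilator R M \<cdot> I \<subseteq> I"
    using ideal_prod_inter[OF annihilator_ideal I] by blast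
  from w show ?thesis
  proof induction
    case (prod i j)
    then show ?case using f by (auto simp: mod_hom_ideal_module annihilator_def)
  next
    case (sum s1 s2)
    then show ?case using f sub by (auto simp: mod_hom_ideal_module subset_iff)
  qed
qed

end

section \<open>Generation determines the colon ideal\<close>

lemma direct_sum_induct [consumes 2, case_names zero step]:
  assumes N: "module R N" and f: "f \<in> carrier (direct_sum_copies N \<Lambda>)"
    and zero: "P \<zero>\<^bsub>direct_sum_copies N \<Lambda>\<^esub>"
    and step: "\<And>g i x. g \<in> carrier (direct_sum_copies N \<Lambda>) \<Longrightarrow> P g \<Longrightarrow> i \<in> \<Lambda> \<Longrightarrow> x \<in> carrier N \<Longrightarrow>
      P (g \<oplus>\<^bsub>direct_sum_copies N \<Lambda>\<^esub> (\<lambda>j\<in>\<Lambda>. if j = i then x else \<zero>\<^bsub>N\<^esub>))"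
  shows "P f"
  using f
proof (induction "card {i \<in> \<Lambda>. f i \<noteq> \<zero>\<^bsub>N\<^esub>}" arbitrary: f)
  case (0 f)
  then have "f = \<zero>\<^bsub>direct_sum_copies N \<Lambda>\<^esub>"
    by (intro extensionalityI[where A = \<Lambda>]) (auto simp: direct_sum_copies_def PiE_def)
  then show ?case using zero by simp
next
  case (Suc k f)
  interpret module R N by fact
  let ?D = "direct_sum_copies N \<Lambda>"
  have fin: "finite {i \<in> \<Lambda>. f i \<noteq> \<zero>\<^bsub>N\<^esub>}" using Suc.prems by (simp add: direct_sum_copies_def)
  from Suc have "{i \<in> \<Lambda>. f i \<noteq> \<zero>\<^bsub>N\<^esub>} \<noteq> {}" by (metis card.empty nat.distinct(1))
  then obtain i where i: "i \<in> \<Lambda>" "f i \<noteq> \<zero>\<^bsub>N\<^esub>" by auto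
  define g where "g = (\<lambda>j\<in>\<Lambda>. if j = i then \<zero>\<^bsub>N\<^esub> else f j)"
  have supp: "{j \<in> \<Lambda>. g j \<noteq> \<zero>\<^bsub>N\<^esub>} = {j \<in> \<Lambda>. f j \<noteq> \<zero>\<^bsub>N\<^esub>} - {i}" by (auto simp: g_def)
  have "g \<in> \<Lambda> \<rightarrow>\<^sub>E carrier N" using Suc.prems by (auto simp: g_def direct_sum_copies_def)
  then have g: "g \<in> carrier ?D" using fin by (simp add: direct_sum_copies_def supp)
  have "k = card {j \<in> \<Lambda>. g j \<noteq> \<zero>\<^bsub>N\<^esub>}"
    unfolding supp using Suc.hyps(2) i fin by (simp add: card_Diff_singleton)
  then have "P g" using Suc.hyps(1) g by blast
  have "f = g \<oplus>\<^bsub>?D\<^esub> (\<lambda>j\<in>\<Lambda>. if j = i then f i else \<zero>\<^bsub>N\<^esub>)"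
    using Suc.prems by (intro extensionalityI[where A = \<Lambda>])
      (auto simp: g_def direct_sum_copies_def PiE_def Pi_def)
  moreover have "f i \<in> carrier N" using Suc.prems i by (auto simp: direct_sum_copies_def)
  ultimately show ?case using step[OF g \<open>P g\<close> i(1)] by metis
qed

text \<open>Restricted to each summand, the epimorphism is a homomorphism \<open>I \<rightarrow> M\<close> and vanishes on
  \<open>\<aa> I\<close>. An \<open>r\<close> in the colon ideal carries every summand into \<open>\<aa> I\<close>, so it kills the image,
  which is all of \<open>M\<close>.\<close>

lemma (in module) generated_imp_colon:
  assumes I: "ideal I R" and gen: "generated_by R (ideal_module R I) M"
  shows "annihilator R M = ideal_colon R (annihilator R M \<cdot> I) I"
proof
  show "annihilator R M \<subseteq> ideal_colon R (annihilator R M \<cdot> I) I"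
    by (auto simp: ideal_colon_def annihilator_def intro: ideal_prod.prod)
next
  let ?N = "ideal_module R I"
  obtain \<Lambda> :: "('a \<Rightarrow> 'c) set" and h where h: "h \<in> mod_epi R (direct_sum_copies ?N \<Lambda>) M"
    using gen unfolding generated_by_def by blast
  let ?D = "direct_sum_copies ?N \<Lambda>"
  interpret I: ideal I R by fact
  have N: "module R ?N" by (rule ideal_module_module[OF R.is_cring I])
  interpret D: module R ?D by (rule direct_sum_copies_module[OF N])
  have h_cl: "\<And>x. x \<in> carrier ?D \<Longrightarrow> h x \<in> carrier M"
    and h_add: "\<And>x y. x \<in> carrier ?D \<Longrightarrow> y \<in> carrier ?D \<Longrightarrow> h (x \<oplus>\<^bsub>?D\<^esub> y) = h x \<oplus>\<^bsub>M\<^esub> h y"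
    and h_smult: "\<And>r x. r \<in> carrier R \<Longrightarrow> x \<in> carrier ?D \<Longrightarrow> h (r \<odot>\<^bsub>?D\<^esub> x) = r \<odot>\<^bsub>M\<^esub> h x"
    and h_surj: "h ` carrier ?D = carrier M"
    using h by (auto simp: mod_epi_def mod_hom_def)
  define \<iota> where "\<iota> i x = (\<lambda>j\<in>\<Lambda>. if j = i then x else \<zero>\<^bsub>?N\<^esub>)" for i x
  have [simp]: "\<zero>\<^bsub>?N\<^esub> = \<zero>" "carrier ?N = I" by (simp_all add: ideal_module_def)
  have \<iota>_cl: "\<iota> i x \<in> carrier ?D" if "i \<in> \<Lambda>" "x \<in> I" for i x
  proof -
    have "{j \<in> \<Lambda>. \<iota> i x j \<noteq> \<zero>} \<subseteq> {i}" by (auto simp: \<iota>_def)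
    then have "finite {j \<in> \<Lambda>. \<iota> i x j \<noteq> \<zero>}" by (rule finite_subset) simp
    then show ?thesis using that by (auto simp: direct_sum_copies_def \<iota>_def)
  qed
  have \<iota>_add: "\<iota> i (x \<oplus> y) = \<iota> i x \<oplus>\<^bsub>?D\<^esub> \<iota> i y" for i x y
    by (auto simp: \<iota>_def direct_sum_copies_def ideal_module_def intro!: restrict_ext)
  have \<iota>_smult: "\<iota> i (r \<otimes> x) = r \<odot>\<^bsub>?D\<^esub> \<iota> i x" if "r \<in> carrier R" for i r x
    using that by (auto simp: \<iota>_def direct_sum_copies_def ideal_module_def intro!: restrict_ext)
  have hom: "(\<lambda>x. h (\<iota> i x)) \<in> mod_hom R ?N M" if "i \<in> \<Lambda>" for i
    using that by (auto simp: mod_hom_ideal_module \<iota>_cl \<iota>_add \<iota>_smult h_cl h_add h_smult)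
  show "ideal_colon R (annihilator R M \<cdot> I) I \<subseteq> annihilator R M"
  proof
    fix r assume "r \<in> ideal_colon R (annihilator R M \<cdot> I) I"
    then have r: "r \<in> carrier R" and rI: "\<And>x. x \<in> I \<Longrightarrow> r \<otimes> x \<in> annihilator R M \<cdot> I"
      by (auto simp: ideal_colon_def)
    have kill: "r \<odot>\<^bsub>M\<^esub> h g = \<zero>\<^bsub>M\<^esub>" if "g \<in> carrier ?D" for g
      using N that
    proof (induction rule: direct_sum_induct)
      case zero
      have "h \<zero>\<^bsub>?D\<^esub> = \<zero>\<^bsub>M\<^esub>" using h_smult[of \<zero> "\<zero>\<^bsub>?D\<^esub>"] by (simp add: h_cl)
      then show ?case using r by simp
    next
      case (step g i x)
      have x: "x \<in> I" using step by simp
      have "r \<odot>\<^bsub>M\<^esub> h (\<iota> i x) = \<zero>\<^bsub>M\<^esub>"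
        using hom_kills_annihilator_prod[OF I hom[OF \<open>i \<in> \<Lambda>\<close>] rI[OF x]]
        by (simp add: \<iota>_smult h_smult r \<iota>_cl step x)
      then show ?case
        using step x r by (fold \<iota>_def) (simp add: h_add \<iota>_cl h_cl smult_r_distr)
    qed
    then have "\<forall>x\<in>h ` carrier ?D. r \<odot>\<^bsub>M\<^esub> x = \<zero>\<^bsub>M\<^esub>" by blast
    then show "r \<in> annihilator R M"
      unfolding h_surj annihilator_def using r by blast
  qed
qed

section \<open>Uniserial modules over a noetherian local ring\<close>

locale uniserial_over_local = module +
  fixes \<mm> :: "'a set" and n :: nat and C :: "nat \<Rightarrow> 'c set"
  assumes local_R: "local_ring R \<mm>" and noetherian_R: "noetherian_ring R"
    and uniserial_M: "uniserial R M" and series: "composition_series R M n C"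
begin

lemma maximal_ideal: "ideal \<mm> R"
proof -
  interpret local_ring R \<mm> by (rule local_R)
  show ?thesis by (rule is_ideal)
qed

lemma unit_or_maximal: "r \<in> carrier R \<Longrightarrow> r \<in> \<mm> \<or> r \<in> Units R"
  using local_ring_unit[OF local_R noetherian_R] by blast

lemma maximal_not_one: "\<one> \<notin> \<mm>"
proof -
  interpret local_ring R \<mm> by (rule local_R)
  show ?thesis using I_notcarr one_imp_carrier by blast
qed

lemma submodules_chain:
  "submodule N R M \<Longrightarrow> submodule N' R M \<Longrightarrow> N \<subseteq> N' \<or> N' \<subseteq> N"
  using uniserial_M by (auto simp: uniserial_def)

lemma series_bot: "C 0 = {\<zero>\<^bsub>M\<^esub>}" and series_top: "C n = carrier M"
  and series_submodule: "i \<le> n \<Longrightarrow> submodule (C i) R M"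
  and series_strict: "i < n \<Longrightarrow> C i \<subset> C (Suc i)"
  and series_simple: "i < n \<Longrightarrow> submodule N R M \<Longrightarrow> C i \<subset> N \<Longrightarrow> \<not> N \<subset> C (Suc i)"
  using series by (auto simp: composition_series_def)

lemma series_carrier: "i \<le> n \<Longrightarrow> C i \<subseteq> carrier M"
  using submoduleE(1)[OF series_submodule] by blast

text \<open>Finitely many cyclic submodules, forming a chain, cover \<open>N\<close>; the largest of them is \<open>N\<close>.\<close>

lemma submodule_is_cyclic:
  assumes N: "submodule N R M"
  obtains z where "z \<in> N" and "N = (\<lambda>r. r \<odot>\<^bsub>M\<^esub> z) ` carrier R"
proof -
  let ?cyc = "\<lambda>z. (\<lambda>r. r \<odot>\<^bsub>M\<^esub> z) ` carrier R"
  have NM: "N \<subseteq> carrier M" by (rule submoduleE(1)[OF N])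
  have "?cyc ` N \<subseteq> {N. submodule N R M}" using NM submodule_cyclic by blast
  then have "finite (?cyc ` N)"
    using uniserial_M finite_subset by (auto simp: uniserial_def)
  moreover have "?cyc ` N \<noteq> {}" using submoduleE(2)[OF N] by simp
  ultimately obtain Z where "Z \<in> ?cyc ` N" and max': "\<forall>B\<in>?cyc ` N. Z \<le> B \<longrightarrow> Z = B"
    using finite_has_maximal[of "?cyc ` N"] by auto
  then obtain z where z: "z \<in> N" and max: "\<And>w. w \<in> N \<Longrightarrow> ?cyc z \<subseteq> ?cyc w \<Longrightarrow> ?cyc z = ?cyc w"
    by auto
  have "N = ?cyc z"
  proof
    show "?cyc z \<subseteq> N" using submoduleE(4)[OF N] z by auto
    show "N \<subseteq> ?cyc z"
    proof
      fix w assume w: "w \<in> N"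
      have "?cyc w \<subseteq> ?cyc z"
        using submodules_chain[of "?cyc w" "?cyc z"] submodule_cyclic max[OF w] z w NM by blast
      moreover have "w \<in> ?cyc w" using w NM by (intro image_eqI[of _ _ \<one>]) auto
      ultimately show "w \<in> ?cyc z" by blast
    qed
  qed
  with z show thesis by (rule that)
qed

text \<open>By total ordering, the terms of a composition series are the only submodules; this is the form
  in which that is used.\<close>

lemma submodule_below:
  assumes i: "i < n" and N: "submodule N R M" and "\<not> C (Suc i) \<subseteq> N"
  shows "N \<subseteq> C i"
proof -
  have "N \<subset> C (Suc i)"
    using submodules_chain[OF N series_submodule[of "Suc i"]] assms by auto
  then show ?thesis
    using submodules_chain[OF N series_submodule[of i]] series_simple[OF i N] i by auto
qed

text \<open>With \<open>C (Suc i) = R z\<close>, the submodule \<open>\<mm> z\<close> is proper by Nakayama (if \<open>z = c z\<close> with \<open>c \<in> \<mm>\<close>,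
  the unit \<open>1 - c\<close> kills \<open>z\<close>), and \<open>C i\<close>, the largest proper submodule, consists of non-unit
  multiples of \<open>z\<close>.\<close>

lemma series_step:
  assumes i: "i < n" and z: "z \<in> carrier M" and gen: "C (Suc i) = (\<lambda>r. r \<odot>\<^bsub>M\<^esub> z) ` carrier R"
  shows "C i = (\<lambda>r. r \<odot>\<^bsub>M\<^esub> z) ` \<mm>"
proof
  interpret m: ideal \<mm> R by (rule maximal_ideal)
  have z_mem: "z \<in> C (Suc i)" unfolding gen using z by (intro image_eqI[of _ _ \<one>]) auto
  show "C i \<subseteq> (\<lambda>r. r \<odot>\<^bsub>M\<^esub> z) ` \<mm>"
  proof
    fix w assume w: "w \<in> C i"
    then obtain r where r: "r \<in> carrier R" "w = r \<odot>\<^bsub>M\<^esub> z"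
      using series_strict[OF i] gen by auto
    have "r \<notin> Units R"
    proof
      assume u: "r \<in> Units R"
      then have "inv r \<odot>\<^bsub>M\<^esub> w = z"
        unfolding r(2) using z r(1) by (simp add: smult_assoc1[symmetric])
      then have "z \<in> C i" using submoduleE(4)[OF series_submodule _ w] u i by force
      then have "C (Suc i) \<subseteq> C i"
        unfolding gen using submoduleE(4)[OF series_submodule] i by auto
      then show False using series_strict[OF i] by blast
    qed
    then show "w \<in> (\<lambda>r. r \<odot>\<^bsub>M\<^esub> z) ` \<mm>" using r unit_or_maximal by blast
  qed
  show "(\<lambda>r. r \<odot>\<^bsub>M\<^esub> z) ` \<mm> \<subseteq> C i"
  proof (rule submodule_below[OF i submodule_ideal_smult[OF maximal_ideal z]], rule notI)
    assume "C (Suc i) \<subseteq> (\<lambda>r. r \<odot>\<^bsub>M\<^esub> z) ` \<mm>"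
    then obtain c where c: "c \<in> \<mm>" "z = c \<odot>\<^bsub>M\<^esub> z" using z_mem by blast
    have cR: "c \<in> carrier R" using c m.Icarr by blast
    have zero: "(\<one> \<ominus> c) \<odot>\<^bsub>M\<^esub> z = \<zero>\<^bsub>M\<^esub>"
      by (rule smult_eq_imp_diff_zero) (use c cR z in auto)
    have "\<one> \<ominus> c \<notin> \<mm>"
    proof
      assume "\<one> \<ominus> c \<in> \<mm>"
      then have "(\<one> \<ominus> c) \<oplus> c \<in> \<mm>" using c by blast
      moreover have "(\<one> \<ominus> c) \<oplus> c = \<one>" using cR by algebra
      ultimately show False using maximal_not_one by simp
    qed
    then have u: "\<one> \<ominus> c \<in> Units R" using unit_or_maximal cR by blast
    have "z = inv (\<one> \<ominus> c) \<odot>\<^bsub>M\<^esub> ((\<one> \<ominus> c) \<odot>\<^bsub>M\<^esub> z)"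
      using z u cR by (simp add: smult_assoc1[symmetric])
    then have "z = \<zero>\<^bsub>M\<^esub>" using zero u by simp
    then have "C (Suc i) \<subseteq> {\<zero>\<^bsub>M\<^esub>}" unfolding gen by auto
    moreover have "\<zero>\<^bsub>M\<^esub> \<in> C i"
      using series_submodule[of i] i subgroup.one_closed[OF submodule.axioms(1)] by fastforce
    ultimately show False using series_strict[OF i] by blast
  qed
qed

lemma maximal_smult_series:
  assumes i: "i < n" and c: "c \<in> \<mm>" and w: "w \<in> C (Suc i)"
  shows "c \<odot>\<^bsub>M\<^esub> w \<in> C i"
proof -
  interpret m: ideal \<mm> R by (rule maximal_ideal)
  obtain z where z: "z \<in> C (Suc i)" and gen: "C (Suc i) = (\<lambda>r. r \<odot>\<^bsub>M\<^esub> z) ` carrier R"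
    using submodule_is_cyclic[OF series_submodule[of "Suc i"]] i by auto
  have zM: "z \<in> carrier M" using z series_carrier[of "Suc i"] i by auto
  obtain s where s: "s \<in> carrier R" "w = s \<odot>\<^bsub>M\<^esub> z" using w gen by auto
  have "c \<odot>\<^bsub>M\<^esub> w = (c \<otimes> s) \<odot>\<^bsub>M\<^esub> z" using s zM c m.Icarr by (simp add: smult_assoc1)
  moreover have "c \<otimes> s \<in> \<mm>" using c s(1) by (rule m.I_r_closed)
  ultimately show ?thesis using series_step[OF i zM gen] by blast
qed

lemma generator:
  obtains x where "x \<in> carrier M" and "carrier M = (\<lambda>r. r \<odot>\<^bsub>M\<^esub> x) ` carrier R"
  using submodule_is_cyclic[OF carrier_is_submodule] by blast

lemma annihilator_generator:
  assumes x: "x \<in> carrier M" and gen: "carrier M = (\<lambda>r. r \<odot>\<^bsub>M\<^esub> x) ` carrier R"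
    and r: "r \<in> carrier R"
  shows "r \<in> annihilator R M \<longleftrightarrow> r \<odot>\<^bsub>M\<^esub> x = \<zero>\<^bsub>M\<^esub>"
proof
  assume zero: "r \<odot>\<^bsub>M\<^esub> x = \<zero>\<^bsub>M\<^esub>"
  have "r \<odot>\<^bsub>M\<^esub> w = \<zero>\<^bsub>M\<^esub>" if w: "w \<in> carrier M" for w
  proof -
    obtain s where s: "s \<in> carrier R" "w = s \<odot>\<^bsub>M\<^esub> x" using w gen by auto
    have "r \<odot>\<^bsub>M\<^esub> w = (s \<otimes> r) \<odot>\<^bsub>M\<^esub> x" using s r x by (simp add: smult_assoc1[symmetric] R.m_comm)
    then show ?thesis using s r x zero by (simp add: smult_assoc1)
  qed
  then show "r \<in> annihilator R M" using r by (simp add: annihilator_def)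
qed (use x in \<open>auto simp: annihilator_def\<close>)

text \<open>Multiplication by \<open>\<mm>\<close> goes down exactly one step in the composition series. The ideal property
  of the power is proved along with this because the inductive step forms the product of the
  ideals \<open>\<mm>\<^sup>k\<close> and \<open>\<mm>\<close>.\<close>

lemma maximal_power_smult:
  assumes x: "x \<in> carrier M" and gen: "carrier M = (\<lambda>r. r \<odot>\<^bsub>M\<^esub> x) ` carrier R" and "k \<le> n"
  shows "ideal (\<mm> [^]\<^bsub>ideals_set R\<^esub> k) R \<and>
    (\<lambda>r. r \<odot>\<^bsub>M\<^esub> x) ` (\<mm> [^]\<^bsub>ideals_set R\<^esub> k) = C (n - k)"
  using \<open>k \<le> n\<close>
proof (induction k)
  case 0
  then show ?case using gen R.oneideal by (simp add: ideals_set_def series_top)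
next
  case (Suc k)
  interpret m: ideal \<mm> R by (rule maximal_ideal)
  let ?P = "\<mm> [^]\<^bsub>ideals_set R\<^esub> k"
  have P: "ideal ?P R" and img: "(\<lambda>r. r \<odot>\<^bsub>M\<^esub> x) ` ?P = C (n - k)" using Suc by auto
  interpret P: ideal ?P R by (rule P)
  have pow: "\<mm> [^]\<^bsub>ideals_set R\<^esub> Suc k = ?P \<cdot> \<mm>" by (simp add: ideals_set_def)
  have Pm: "ideal (?P \<cdot> \<mm>) R" by (rule R.ideal_prod_is_ideal[OF P maximal_ideal])
  let ?i = "n - Suc k"
  have i: "?i < n" and Si: "Suc ?i = n - k" using Suc.prems by auto
  have "(\<lambda>r. r \<odot>\<^bsub>M\<^esub> x) ` (?P \<cdot> \<mm>) = C ?i"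
  proof
    have "s \<odot>\<^bsub>M\<^esub> x \<in> C ?i" if "s \<in> ?P \<cdot> \<mm>" for s
      using that
    proof induction
      case (prod p c)
      have "p \<odot>\<^bsub>M\<^esub> x \<in> C (Suc ?i)" unfolding Si img[symmetric] using prod by blast
      from maximal_smult_series[OF i prod(2) this] show ?case
        using prod x by (simp add: smult_assoc1[symmetric] R.m_comm P.Icarr m.Icarr)
    next
      case (sum s t)
      then have "s \<in> carrier R" "t \<in> carrier R" using ideal.Icarr[OF Pm] by blast+
      then show ?case using sum x submoduleE(5)[OF series_submodule[of ?i]] i
        by (simp add: smult_l_distr)
    qed
    then show "(\<lambda>r. r \<odot>\<^bsub>M\<^esub> x) ` (?P \<cdot> \<mm>) \<subseteq> C ?i" by blast
    obtain z where z: "z \<in> C (Suc ?i)" and zgen: "C (Suc ?i) = (\<lambda>r. r \<odot>\<^bsub>M\<^esub> z) ` carrier R"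
      using submodule_is_cyclic[OF series_submodule[of "Suc ?i"]] i by auto
    have zM: "z \<in> carrier M" using z series_carrier[of "Suc ?i"] i by auto
    obtain p where p: "p \<in> ?P" "z = p \<odot>\<^bsub>M\<^esub> x" using z unfolding Si img[symmetric] by blast
    show "C ?i \<subseteq> (\<lambda>r. r \<odot>\<^bsub>M\<^esub> x) ` (?P \<cdot> \<mm>)"
    proof
      fix w assume "w \<in> C ?i"
      then obtain c where c: "c \<in> \<mm>" "w = c \<odot>\<^bsub>M\<^esub> z" using series_step[OF i zM zgen] by auto
      have "w = (p \<otimes> c) \<odot>\<^bsub>M\<^esub> x"
        using c p x by (simp add: smult_assoc1[symmetric] R.m_comm P.Icarr m.Icarr)
      then show "w \<in> (\<lambda>r. r \<odot>\<^bsub>M\<^esub> x) ` (?P \<cdot> \<mm>)" using ideal_prod.prod[OF p(1) c(1)] by blast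
    qed
  qed
  then show ?case using Pm pow by simp
qed

lemma maximal_power_not_annihilator:
  assumes "n \<ge> 1"
  shows "\<not> \<mm> [^]\<^bsub>ideals_set R\<^esub> (n - 1) \<subseteq> annihilator R M"
proof
  assume sub: "\<mm> [^]\<^bsub>ideals_set R\<^esub> (n - 1) \<subseteq> annihilator R M"
  obtain x where x: "x \<in> carrier M" and gen: "carrier M = (\<lambda>r. r \<odot>\<^bsub>M\<^esub> x) ` carrier R"
    by (rule generator)
  have "C 1 = (\<lambda>r. r \<odot>\<^bsub>M\<^esub> x) ` (\<mm> [^]\<^bsub>ideals_set R\<^esub> (n - 1))"
    using maximal_power_smult[OF x gen, of "n - 1"] assms by simp
  also have "\<dots> \<subseteq> {\<zero>\<^bsub>M\<^esub>}" using sub x by (auto simp: annihilator_def)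
  finally show False using series_strict[of 0] assms series_bot by auto
qed

text \<open>If \<open>J\<close> is not \<open>\<aa>\<close>, then \<open>J x\<close> is nonzero and so contains the smallest nonzero submodule
  \<open>C 1 = \<mm>\<^sup>n\<^sup>-\<^sup>1 x\<close>; subtracting an element of \<open>\<aa> \<subseteq> J\<close> gives \<open>\<mm>\<^sup>n\<^sup>-\<^sup>1 \<subseteq> J\<close>.\<close>

lemma ideal_above_annihilator:
  assumes "n \<ge> 1" and J: "ideal J R" and sub: "annihilator R M \<subseteq> J"
    and not_sub: "\<not> \<mm> [^]\<^bsub>ideals_set R\<^esub> (n - 1) \<subseteq> J"
  shows "J = annihilator R M"
proof
  interpret J: ideal J R by (rule J)
  obtain x where x: "x \<in> carrier M" and gen: "carrier M = (\<lambda>r. r \<odot>\<^bsub>M\<^esub> x) ` carrier R"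
    by (rule generator)
  let ?P = "\<mm> [^]\<^bsub>ideals_set R\<^esub> (n - 1)"
  have P: "ideal ?P R" and C1: "(\<lambda>r. r \<odot>\<^bsub>M\<^esub> x) ` ?P = C 1"
    using maximal_power_smult[OF x gen, of "n - 1"] assms(1) by auto
  have "\<not> C (Suc 0) \<subseteq> (\<lambda>r. r \<odot>\<^bsub>M\<^esub> x) ` J"
  proof
    assume C1J: "C (Suc 0) \<subseteq> (\<lambda>r. r \<odot>\<^bsub>M\<^esub> x) ` J"
    have "?P \<subseteq> J"
    proof
      fix p assume p: "p \<in> ?P"
      then obtain j where j: "j \<in> J" "p \<odot>\<^bsub>M\<^esub> x = j \<odot>\<^bsub>M\<^esub> x" using C1 C1J by (auto 4 3)
      have pj: "p \<in> carrier R" "j \<in> carrier R" using p j ideal.Icarr[OF P] J.Icarr by auto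
      have "p \<ominus> j \<in> J"
        using smult_eq_imp_diff_zero[OF pj x j(2)] annihilator_generator[OF x gen] pj sub by blast
      then have "(p \<ominus> j) \<oplus> j \<in> J" using j by blast
      moreover have "(p \<ominus> j) \<oplus> j = p" using pj by algebra
      ultimately show "p \<in> J" by simp
    qed
    then show False using not_sub by blast
  qed
  then have "(\<lambda>r. r \<odot>\<^bsub>M\<^esub> x) ` J \<subseteq> {\<zero>\<^bsub>M\<^esub>}"
    using submodule_below[OF _ submodule_ideal_smult[OF J x], of 0] assms(1) series_bot by auto
  then show "J \<subseteq> annihilator R M" using annihilator_generator[OF x gen] J.Icarr by blast
qed (rule sub)

text \<open>This double annihilator property is what makes \<open>R / \<aa>\<close> self-injective. If \<open>w\<close> is not a
  multiple of \<open>z\<close>, then \<open>z = c w\<close> with \<open>c \<in> \<mm>\<close>, and the hypothesis makes multiplication by \<open>c\<close>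
  injective on \<open>R w\<close>. But \<open>c\<close> acts nilpotently on \<open>M\<close>, so \<open>w = 0\<close>.\<close>

lemma annihilated_imp_mem_cyclic:
  assumes z: "z \<in> carrier M" and w: "w \<in> carrier M"
    and ann: "\<And>r. r \<in> carrier R \<Longrightarrow> r \<odot>\<^bsub>M\<^esub> z = \<zero>\<^bsub>M\<^esub> \<Longrightarrow> r \<odot>\<^bsub>M\<^esub> w = \<zero>\<^bsub>M\<^esub>"
  shows "w \<in> (\<lambda>r. r \<odot>\<^bsub>M\<^esub> z) ` carrier R"
proof (cases "w \<in> (\<lambda>r. r \<odot>\<^bsub>M\<^esub> z) ` carrier R")
  case False
  have "w \<in> (\<lambda>r. r \<odot>\<^bsub>M\<^esub> w) ` carrier R" "z \<in> (\<lambda>r. r \<odot>\<^bsub>M\<^esub> z) ` carrier R"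
    using z w by (auto intro: image_eqI[of _ _ \<one>])
  then have "z \<in> (\<lambda>r. r \<odot>\<^bsub>M\<^esub> w) ` carrier R"
    using False submodules_chain[OF submodule_cyclic[OF z] submodule_cyclic[OF w]] by blast
  then obtain c where c: "c \<in> carrier R" "z = c \<odot>\<^bsub>M\<^esub> w" by blast
  have "c \<notin> Units R"
  proof
    assume u: "c \<in> Units R"
    then have "w = inv c \<odot>\<^bsub>M\<^esub> z" using c w by (simp add: smult_assoc1[symmetric])
    then show False using False u by blast
  qed
  then have cm: "c \<in> \<mm>" using unit_or_maximal c by blast
  \<comment> \<open>Multiplying by \<open>c\<close> moves \<open>R w \<inter> C (Suc i)\<close> injectively into \<open>R w \<inter> C i\<close>.\<close>
  have "i \<le> n \<Longrightarrow> s \<in> carrier R \<Longrightarrow> s \<odot>\<^bsub>M\<^esub> w \<in> C i \<Longrightarrow> s \<odot>\<^bsub>M\<^esub> w = \<zero>\<^bsub>M\<^esub>" for i s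
  proof (induction i arbitrary: s)
    case 0
    then show ?case using series_bot by simp
  next
    case (Suc i)
    have "c \<odot>\<^bsub>M\<^esub> (s \<odot>\<^bsub>M\<^esub> w) \<in> C i"
      using maximal_smult_series[OF _ cm] Suc by simp
    then have "(c \<otimes> s) \<odot>\<^bsub>M\<^esub> w = \<zero>\<^bsub>M\<^esub>"
      using Suc.IH[of "c \<otimes> s"] Suc.prems c w by (simp add: smult_assoc1)
    then have "s \<odot>\<^bsub>M\<^esub> z = \<zero>\<^bsub>M\<^esub>"
      using c w Suc by (simp add: smult_assoc1[symmetric] R.m_comm)
    then show ?case using ann Suc by blast
  qed
  from this[of n \<one>] have "w = \<zero>\<^bsub>M\<^esub>" using w series_top by simp
  then show ?thesis using z by (intro image_eqI[of _ _ \<zero>]) auto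
qed

text \<open>Modulo \<open>\<aa>\<close> the ideal of all \<open>r\<close> with \<open>r v \<in> N\<close> is generated by one element \<open>t\<close>, so the only
  condition on \<open>y\<close> is \<open>t y = f (t v)\<close>. It can be solved since whatever kills \<open>t x\<close> lies, times
  \<open>t\<close>, in \<open>\<aa>\<close> and hence kills \<open>f (t v)\<close>.\<close>

lemma hom_extension_value:
  assumes N: "ideal N R" and f: "f \<in> mod_hom R (ideal_module R N) M" and v: "v \<in> carrier R"
    and ann: "\<And>a. a \<in> annihilator R M \<Longrightarrow> a \<otimes> v \<in> N \<and> f (a \<otimes> v) = \<zero>\<^bsub>M\<^esub>"
  obtains y where "y \<in> carrier M"
    and "\<And>r. r \<in> carrier R \<Longrightarrow> r \<otimes> v \<in> N \<Longrightarrow> f (r \<otimes> v) = r \<odot>\<^bsub>M\<^esub> y"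
proof -
  interpret N: ideal N R by fact
  have f_cl: "\<And>w. w \<in> N \<Longrightarrow> f w \<in> carrier M"
    and f_add: "\<And>w w'. w \<in> N \<Longrightarrow> w' \<in> N \<Longrightarrow> f (w \<oplus> w') = f w \<oplus>\<^bsub>M\<^esub> f w'"
    and f_smult: "\<And>r w. r \<in> carrier R \<Longrightarrow> w \<in> N \<Longrightarrow> f (r \<otimes> w) = r \<odot>\<^bsub>M\<^esub> f w"
    using f unfolding mod_hom_ideal_module by auto
  obtain x where x: "x \<in> carrier M" and gen: "carrier M = (\<lambda>r. r \<odot>\<^bsub>M\<^esub> x) ` carrier R"
    by (rule generator)
  note ann_x = annihilator_generator[OF x gen]
  let ?K = "{r \<in> carrier R. v \<otimes> r \<in> N}"
  have K: "ideal ?K R" by (rule N.helper_max_prime[OF R.is_cring v])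
  obtain z where zK: "z \<in> (\<lambda>r. r \<odot>\<^bsub>M\<^esub> x) ` ?K"
    and Kgen: "(\<lambda>r. r \<odot>\<^bsub>M\<^esub> x) ` ?K = (\<lambda>r. r \<odot>\<^bsub>M\<^esub> z) ` carrier R"
    by (rule submodule_is_cyclic[OF submodule_ideal_smult[OF K x]])
  obtain t where t: "t \<in> carrier R" "t \<otimes> v \<in> N" and z: "z = t \<odot>\<^bsub>M\<^esub> x"
    using zK v by (auto simp: R.m_comm)
  have zM: "z \<in> carrier M" using z t x by simp
  have "f (t \<otimes> v) \<in> (\<lambda>r. r \<odot>\<^bsub>M\<^esub> z) ` carrier R"
  proof (rule annihilated_imp_mem_cyclic[OF zM f_cl[OF t(2)]])
    fix s assume s: "s \<in> carrier R" and "s \<odot>\<^bsub>M\<^esub> z = \<zero>\<^bsub>M\<^esub>"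
    then have "s \<otimes> t \<in> annihilator R M" using ann_x t x z by (simp add: smult_assoc1)
    from ann[OF this] show "s \<odot>\<^bsub>M\<^esub> f (t \<otimes> v) = \<zero>\<^bsub>M\<^esub>"
      using f_smult[OF s t(2)] s t v by (simp add: R.m_assoc)
  qed
  then obtain s where s: "s \<in> carrier R" and ftv: "f (t \<otimes> v) = s \<odot>\<^bsub>M\<^esub> z" by blast
  have y: "s \<odot>\<^bsub>M\<^esub> x \<in> carrier M" using s x by simp
  have ftv': "f (t \<otimes> v) = t \<odot>\<^bsub>M\<^esub> (s \<odot>\<^bsub>M\<^esub> x)"
    unfolding ftv z using s t x by (simp add: smult_assoc1[symmetric] R.m_comm)
  have "f (r \<otimes> v) = r \<odot>\<^bsub>M\<^esub> (s \<odot>\<^bsub>M\<^esub> x)" if r: "r \<in> carrier R" "r \<otimes> v \<in> N" for r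
  proof -
    have "r \<odot>\<^bsub>M\<^esub> x \<in> (\<lambda>r. r \<odot>\<^bsub>M\<^esub> z) ` carrier R"
      unfolding Kgen[symmetric] using r v by (auto simp: R.m_comm)
    then obtain q where q: "q \<in> carrier R" and rx: "r \<odot>\<^bsub>M\<^esub> x = q \<odot>\<^bsub>M\<^esub> z" by blast
    let ?d = "r \<ominus> q \<otimes> t"
    have "r \<odot>\<^bsub>M\<^esub> x = (q \<otimes> t) \<odot>\<^bsub>M\<^esub> x" using rx z q t x by (simp add: smult_assoc1)
    then have d: "?d \<in> annihilator R M"
      using smult_eq_imp_diff_zero[of r "q \<otimes> t" x] ann_x r q t x by simp
    have split: "r = ?d \<oplus> q \<otimes> t" using r q t by algebra
    have "r \<otimes> v = ?d \<otimes> v \<oplus> q \<otimes> (t \<otimes> v)" using r q t v by algebra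
    then have "f (r \<otimes> v) = f (?d \<otimes> v) \<oplus>\<^bsub>M\<^esub> f (q \<otimes> (t \<otimes> v))"
      using f_add ann[OF d] q t N.I_l_closed by simp
    also have "\<dots> = q \<odot>\<^bsub>M\<^esub> (t \<odot>\<^bsub>M\<^esub> (s \<odot>\<^bsub>M\<^esub> x))"
      using ann[OF d] q t y by (simp add: f_smult ftv')
    also have "\<dots> = ?d \<odot>\<^bsub>M\<^esub> (s \<odot>\<^bsub>M\<^esub> x) \<oplus>\<^bsub>M\<^esub> (q \<otimes> t) \<odot>\<^bsub>M\<^esub> (s \<odot>\<^bsub>M\<^esub> x)"
      using d q t y by (simp add: annihilator_def smult_assoc1)
    also have "\<dots> = (?d \<oplus> q \<otimes> t) \<odot>\<^bsub>M\<^esub> (s \<odot>\<^bsub>M\<^esub> x)"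
      using r q t y by (simp add: smult_l_distr)
    finally show ?thesis using split by simp
  qed
  with y show thesis by (rule that)
qed

text \<open>Partial homomorphisms \<open>f\<close> on ideals between \<open>\<aa> I + R u\<close> and \<open>I\<close>, normalised by \<open>f u = x\<close>, are
  extended one element at a time. Vanishing on \<open>\<aa> I\<close> has to be kept as part of the invariant: it
  is what makes the next extension step possible.\<close>

lemma generated_if_not_subset:
  assumes "n \<ge> 1" and I: "ideal I R"
    and not_sub: "\<not> (\<mm> [^]\<^bsub>ideals_set R\<^esub> (n - 1)) \<cdot> I \<subseteq> annihilator R M \<cdot> I"
  shows "generated_by R (ideal_module R I) M"
proof -
  interpret I: ideal I R by fact
  let ?P = "\<mm> [^]\<^bsub>ideals_set R\<^esub> (n - 1)"
  let ?aI = "annihilator R M \<cdot> I"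
  have aI: "ideal ?aI R" by (rule R.ideal_prod_is_ideal[OF annihilator_ideal I])
  interpret aI: ideal ?aI R by (rule aI)
  have aI_sub: "?aI \<subseteq> I" using R.ideal_prod_inter[OF annihilator_ideal I] by blast
  obtain x where x: "x \<in> carrier M" and gen: "carrier M = (\<lambda>r. r \<odot>\<^bsub>M\<^esub> x) ` carrier R"
    by (rule generator)
  obtain p u where p: "p \<in> ?P" and u: "u \<in> I" and pu: "p \<otimes> u \<notin> ?aI"
  proof -
    have "?P \<cdot> I \<subseteq> ?aI" if all: "\<And>p u. p \<in> ?P \<Longrightarrow> u \<in> I \<Longrightarrow> p \<otimes> u \<in> ?aI"
    proof
      fix s assume "s \<in> ?P \<cdot> I"
      then show "s \<in> ?aI" by induction (auto intro: all)
    qed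
    then show thesis using not_sub that by blast
  qed
  have uR: "u \<in> carrier R" using u by (rule I.Icarr)
  let ?J = "{r \<in> carrier R. u \<otimes> r \<in> ?aI}"
  have J: "?J = annihilator R M"
  proof (rule ideal_above_annihilator[OF assms(1)])
    show "ideal ?J R" by (rule aI.helper_max_prime[OF R.is_cring uR])
    show "annihilator R M \<subseteq> ?J"
    proof
      fix a assume a: "a \<in> annihilator R M"
      then have "a \<in> carrier R" by (simp add: annihilator_def)
      then show "a \<in> ?J" using ideal_prod.prod[OF a u, of R] uR by (simp add: R.m_comm)
    qed
    show "\<not> ?P \<subseteq> ?J" using p pu uR by (auto simp: R.m_comm)
  qed
  let ?good = "\<lambda>N f. ideal N R \<and> ?aI \<subseteq> N \<and> N \<subseteq> I \<and> u \<in> N \<and>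
    f \<in> mod_hom R (ideal_module R N) M \<and> (\<forall>w\<in>?aI. f w = \<zero>\<^bsub>M\<^esub>) \<and> f u = x"
  let ?S = "{N. \<exists>f. ?good N f}"
  have extended: "?good (N <+>\<^bsub>R\<^esub> PIdl v) g"
    if N: "ideal N R" "?aI \<subseteq> N" "N \<subseteq> I" and v: "v \<in> I" "u \<in> N \<or> u = v"
      and g: "g \<in> mod_hom R (ideal_module R (N <+>\<^bsub>R\<^esub> PIdl v)) M" "\<forall>w\<in>?aI. g w = \<zero>\<^bsub>M\<^esub>" "g u = x"
    for N v g
  proof -
    have vR: "v \<in> carrier R" using v(1) by (rule I.Icarr)
    show ?thesis
      using R.ideal_adjoin(1-3)[OF N(1) vR] R.ideal_adjoin(4)[OF N(1) vR I N(3) v(1)] N(2) v(2) g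
      by blast
  qed
  have "?S \<noteq> {}"
  proof -
    have zero_hom: "(\<lambda>_. \<zero>\<^bsub>M\<^esub>) \<in> mod_hom R (ideal_module R ?aI) M"
      by (simp add: mod_hom_ideal_module)
    have compat: "\<zero>\<^bsub>M\<^esub> = r \<odot>\<^bsub>M\<^esub> x" if "r \<in> carrier R" "r \<otimes> u \<in> ?aI" for r
    proof -
      have "r \<in> ?J" using that uR by (simp add: R.m_comm)
      then show ?thesis unfolding J using x by (simp add: annihilator_def)
    qed
    obtain g where "g \<in> mod_hom R (ideal_module R (?aI <+>\<^bsub>R\<^esub> PIdl u)) M"
      and "\<And>w. w \<in> ?aI \<Longrightarrow> g w = \<zero>\<^bsub>M\<^esub>" and "g u = x"
      using extend_hom_by_element[OF aI zero_hom uR x compat] by blast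
    then have "?good (?aI <+>\<^bsub>R\<^esub> PIdl u) g" using extended[OF aI _ aI_sub u] by blast
    then show ?thesis by blast
  qed
  moreover have "ideal N R" if "N \<in> ?S" for N using that by blast
  ultimately obtain N where "N \<in> ?S" and max: "\<And>N'. N' \<in> ?S \<Longrightarrow> N \<subseteq> N' \<Longrightarrow> N' = N"
    using noetherian_ring.ideals_have_maximal[OF noetherian_R, of ?S] by blast
  then obtain f where good: "?good N f" by blast
  then have N: "ideal N R" "?aI \<subseteq> N" "N \<subseteq> I" "u \<in> N"
    and f: "f \<in> mod_hom R (ideal_module R N) M" and f_aI: "\<And>w. w \<in> ?aI \<Longrightarrow> f w = \<zero>\<^bsub>M\<^esub>"
    and fu: "f u = x" by auto
  have "I \<subseteq> N"
  proof
    fix v assume v: "v \<in> I"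
    have vR: "v \<in> carrier R" using v by (rule I.Icarr)
    have "a \<otimes> v \<in> N \<and> f (a \<otimes> v) = \<zero>\<^bsub>M\<^esub>" if "a \<in> annihilator R M" for a
      using ideal_prod.prod[OF that v, of R] N(2) f_aI by blast
    then obtain y where y: "y \<in> carrier M"
      and compat: "\<And>r. r \<in> carrier R \<Longrightarrow> r \<otimes> v \<in> N \<Longrightarrow> f (r \<otimes> v) = r \<odot>\<^bsub>M\<^esub> y"
      using hom_extension_value[OF N(1) f vR] by blast
    obtain g where g: "g \<in> mod_hom R (ideal_module R (N <+>\<^bsub>R\<^esub> PIdl v)) M"
      and gf: "\<And>w. w \<in> N \<Longrightarrow> g w = f w" and "g v = y"
      using extend_hom_by_element[OF N(1) f vR y compat] by blast
    have "\<forall>w\<in>?aI. g w = \<zero>\<^bsub>M\<^esub>" "g u = x" using gf N(2,4) f_aI fu by auto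
    then have good': "?good (N <+>\<^bsub>R\<^esub> PIdl v) g" using extended[OF N(1-3) v _ g] N(4) by blast
    have "N <+>\<^bsub>R\<^esub> PIdl v = N"
      using max good' R.ideal_adjoin(2)[OF N(1) vR] by blast
    then show "v \<in> N" using R.ideal_adjoin(3)[OF N(1) vR] by blast
  qed
  then have NI: "N = I" using N(3) by blast
  have "f ` I = carrier M"
  proof
    show "f ` I \<subseteq> carrier M" using f NI by (auto simp: mod_hom_ideal_module)
    show "carrier M \<subseteq> f ` I"
    proof
      fix w assume "w \<in> carrier M"
      then obtain r where r: "r \<in> carrier R" "w = r \<odot>\<^bsub>M\<^esub> x" using gen by auto
      then have "w = f (r \<otimes> u)" using f fu u NI by (auto simp: mod_hom_ideal_module)
      then show "w \<in> f ` I" using I.I_l_closed[OF u r(1)] by blast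
    qed
  qed
  then show ?thesis
    using surjection_imp_generated_by[OF module_axioms I] f NI by blast
qed

end

section \<open>The equivalence\<close>

theorem mainTheorem1:
  fixes R :: "('a, 'm) ring_scheme" (structure)
    and M :: "('a, 'b, 'd) module_scheme"
    and \<mm> I \<aa> :: "'a set" and n :: nat
  assumes "local_ring R \<mm>" and "noetherian_ring R"
    and "ideal I R"
    and "module R M" and "uniserial R M" and "has_length R M n" and "n \<ge> 1"
    and "\<aa> = annihilator R M"
  shows "(generated_by R (ideal_module R I) M \<longleftrightarrow> \<aa> = ideal_colon R (\<aa> \<cdot> I) I) \<and>
    (\<aa> = ideal_colon R (\<aa> \<cdot> I) I \<longleftrightarrow>
      \<not> ((\<mm> [^]\<^bsub>ideals_set R\<^esub> (n - 1)) \<cdot> I \<subseteq> annihilator R M \<cdot> I))"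
proof -
  obtain C where "composition_series R M n C"
    using assms(6) unfolding has_length_def by blast
  then interpret uniserial_over_local R M \<mm> n C
    using assms by (simp add: uniserial_over_local_def uniserial_over_local_axioms_def)
  let ?P = "\<mm> [^]\<^bsub>ideals_set R\<^esub> (n - 1)"
  have "\<aa> = ideal_colon R (\<aa> \<cdot> I) I" if "generated_by R (ideal_module R I) M"
    using generated_imp_colon[OF assms(3) that] assms(8) by simp
  moreover have "\<not> ?P \<cdot> I \<subseteq> annihilator R M \<cdot> I" if colon: "\<aa> = ideal_colon R (\<aa> \<cdot> I) I"
  proof
    assume sub: "?P \<cdot> I \<subseteq> annihilator R M \<cdot> I"
    obtain x where "x \<in> carrier M" and "carrier M = (\<lambda>r. r \<odot>\<^bsub>M\<^esub> x) ` carrier R"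
      by (rule generator)
    then have "ideal ?P R" using maximal_power_smult[of x "n - 1"] by simp
    then have "?P \<subseteq> ideal_colon R (annihilator R M \<cdot> I) I"
      using sub ideal.Icarr by (fastforce simp: ideal_colon_def intro: ideal_prod.prod)
    then show False
      using maximal_power_not_annihilator[OF assms(7)] colon assms(8) by simp
  qed
  moreover have "generated_by R (ideal_module R I) M"
    if "\<not> ?P \<cdot> I \<subseteq> annihilator R M \<cdot> I"
    using generated_if_not_subset[OF assms(7,3) that] .
  ultimately show ?thesis by blast
qed

end
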